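(* Let $X$ and $Y$ be metric spaces and let $f : X \to Y$ be a coarsely continuous map. Then there exist a metric space $Z$ and coarsely continuous maps $g : X \to Z$ and $h : Z \to Y$ such that $f = h \circ g$, $\operatorname{asdim} Z \leq \operatorname{asdim} X$ and $\operatorname{w} Z \leq \operatorname{w} Y$.
   Context: A family of subsets of a metric space is uniformly bounded if the diameters of its members are bounded by a common finite constant. A map $f : X \to Y$ between metric spaces (not assumed continuous) is coarsely continuous if it sends uniformly bounded covers of $X$ to uniformly bounded families in $Y$, i.e. for every uniformly bounded cover $\mathcal{B}$ of $X$ the family $\{f(B) : B \in \mathcal{B}\}$ is uniformly bounded in $Y$. A family of subsets of a metric space is $r$-disjoint if any two points lying in two distinct members of the family are at distance at least $r$. For an integer $n \ge 0$, $\operatorname{asdim} X \leq n$ means that for every $r > 0$ there is a uniformly bounded cover of $X$ that is the union of $n+1$ families each of which is $r$-disjoint; $\operatorname{asdim} X$ is the least such $n$, or $\infty$ if there is none. $\operatorname{w} X$ denotes the weight of $X$, i.e. the least cardinality of a base of the metric topology of $X$. *)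

theory Defs
  imports "HOL-Analysis.Analysis" "HOL-Library.Extended_Nat"
begin

unbundle cardinal_syntax

text \<open>
  Metric spaces are elements of the library type \<^typ>\<open>'a metric\<close>, i.e. a carrier set together
  with a metric on it; the carrier may be empty.
\<close>

text \<open>
  The diameter takes values in \<^typ>\<open>ennreal\<close>, so that unbounded sets have diameter \<open>\<infinity>\<close>
  (the library function \<open>diameter\<close> is real-valued and tied to the type class); the empty set has
  diameter 0.
\<close>

definition mdiameter :: "'a metric \<Rightarrow> 'a set \<Rightarrow> ennreal" where
  "mdiameter X S = (SUP x\<in>S. SUP y\<in>S. ennreal (mdist X x y))"

definition uniformly_bounded :: "'a metric \<Rightarrow> 'a set set \<Rightarrow> bool" where
  "uniformly_bounded X \<B> \<longleftrightarrow>
     (\<forall>B\<in>\<B>. B \<subseteq> mspace X) \<and> (\<exists>C::real. \<forall>B\<in>\<B>. mdiameter X B \<le> ennreal C)"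

definition coarsely_continuous :: "'a metric \<Rightarrow> 'b metric \<Rightarrow> ('a \<Rightarrow> 'b) \<Rightarrow> bool" where
  "coarsely_continuous X Y f \<longleftrightarrow>
     f ` mspace X \<subseteq> mspace Y \<and>
     (\<forall>\<B>. uniformly_bounded X \<B> \<and> \<Union>\<B> = mspace X \<longrightarrow> uniformly_bounded Y ((`) f ` \<B>))"

definition r_disjoint :: "'a metric \<Rightarrow> real \<Rightarrow> 'a set set \<Rightarrow> bool" where
  "r_disjoint X r \<F> \<longleftrightarrow>
     (\<forall>A\<in>\<F>. \<forall>B\<in>\<F>. A \<noteq> B \<longrightarrow> (\<forall>a\<in>A. \<forall>b\<in>B. r \<le> mdist X a b))"

definition asdim_le :: "'a metric \<Rightarrow> nat \<Rightarrow> bool" where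
  "asdim_le X n \<longleftrightarrow>
     (\<forall>r>0. \<exists>\<F> :: nat \<Rightarrow> 'a set set.
        uniformly_bounded X (\<Union>i\<le>n. \<F> i) \<and> \<Union>(\<Union>i\<le>n. \<F> i) = mspace X \<and>
        (\<forall>i\<le>n. r_disjoint X r (\<F> i)))"

text \<open>The infimum of the empty subset of \<^typ>\<open>enat\<close> is \<open>\<infinity>\<close>.\<close>

definition asdim :: "'a metric \<Rightarrow> enat" where
  "asdim X = Inf {enat n | n. asdim_le X n}"

definition base_of :: "'a topology \<Rightarrow> 'a set set \<Rightarrow> bool" where
  "base_of T \<B> \<longleftrightarrow> openin T = arbitrary union_of (\<lambda>U. U \<in> \<B>)"

text \<open>
  Cardinals are represented, as in the library, by well-orders of minimal type; two of them
  (possibly over different types) are compared by \<open>\<le>o\<close>. The minimum below exists, and it is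
  unique up to \<open>=o\<close>; see the lemma that follows.
\<close>

definition weight :: "'a metric \<Rightarrow> 'a set rel" where
  "weight X = (SOME \<kappa>. \<exists>\<B>. base_of (mtopology_of X) \<B> \<and> \<kappa> = |\<B>| \<and>
                 (\<forall>\<B>'. base_of (mtopology_of X) \<B>' \<longrightarrow> |\<B>| \<le>o |\<B>'| ))"

lemma weight_attained:
  "\<exists>\<B>. base_of (mtopology_of X) \<B> \<and> weight X = |\<B>| \<and>
       (\<forall>\<B>'. base_of (mtopology_of X) \<B>' \<longrightarrow> |\<B>| \<le>o |\<B>'| )"
proof -
  let ?T = "mtopology_of X"
  let ?R = "{|\<B>| | \<B>. base_of ?T \<B>}"
  have "openin ?T U \<longleftrightarrow> (arbitrary union_of openin ?T) U" for U
  proof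
    assume "openin ?T U"
    then show "(arbitrary union_of openin ?T) U"
      by (rule arbitrary_union_of_inc)
  next
    assume "(arbitrary union_of openin ?T) U"
    then show "openin ?T U"
      unfolding union_of_def by (metis Ball_Collect openin_Union)
  qed
  then have "openin ?T = arbitrary union_of openin ?T"
    by (rule ext)
  then have "base_of ?T {U. openin ?T U}"
    by (simp add: base_of_def)
  then have "?R \<noteq> {}"
    by blast
  moreover have "\<forall>r\<in>?R. Card_order r"
    using card_of_Card_order by blast
  ultimately have "\<exists>\<kappa>\<in>?R. \<forall>r\<in>?R. \<kappa> \<le>o r"
    by (rule exists_minim_Card_order)
  then obtain \<B> where "base_of ?T \<B>" and min: "\<forall>r\<in>?R. |\<B>| \<le>o r"
    by auto
  moreover have "|\<B>| \<le>o |\<B>'|" if "base_of ?T \<B>'" for \<B>'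
    by (rule bspec[OF min]) (use that in auto)
  ultimately have "\<exists>\<kappa> \<B>. base_of ?T \<B> \<and> \<kappa> = |\<B>| \<and> (\<forall>\<B>'. base_of ?T \<B>' \<longrightarrow> |\<B>| \<le>o |\<B>'| )"
    by blast
  then show ?thesis
    unfolding weight_def by (rule someI_ex)
qed

end

theory Submission
  imports Defs
begin

text \<open>
  If \<open>asdim X = \<infinity>\<close>, or \<open>X\<close> is empty, or \<open>Y\<close> is finite, then \<open>f X\<close> with the metric of \<open>Y\<close> is a
  suitable \<open>Z\<close>: its weight is at most that of \<open>Y\<close>, and a finite space has dimension \<open>0\<close>
  (\<open>factor_through_image\<close>). So let \<open>asdim X = n\<close>, let \<open>X\<close> be nonempty and let every base of \<open>Y\<close>
  be infinite.

  The task is to coarsen \<open>X\<close> until few points are left, keeping its dimension and the coarse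
  continuity of \<open>f\<close>. Cover \<open>X\<close> on scales \<open>k = 0, 1, 2, \<dots>\<close>: the \<open>k\<close>-th cover consists of \<open>n + 1\<close>
  families of pairwise disjoint sets of diameter at most \<open>S k\<close>, and its Lebesgue number exceeds the mesh
  \<open>S (k - 1)\<close> of the preceding cover. Hence a set of scale \<open>k\<close> has at most one parent in each of
  the \<open>n + 1\<close> families of scale \<open>k + 1\<close>, namely the member that contains it. A set also has a
  colour, a small member of a base of \<open>Y\<close> that contains one of its values. Its label records the
  colours of all its ancestors, arranged as a tree. Two points are called \<open>k\<close>-related if they lie
  in sets of scale \<open>k\<close> with equal labels.

  Labels merge sets far apart in \<open>X\<close>, yet they behave as the sets do, because sets with equal
  labels have parents with equal labels. If \<open>x, y\<close> and \<open>y, z\<close> are \<open>k\<close>-related then \<open>x, z\<close> are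
  \<open>(k + 1)\<close>-related: the two sets containing \<open>y\<close> have a common parent (\<open>related_comp\<close>). The union
  of the sets of one family and one label, shrunk by the Lebesgue number, cannot be \<open>k\<close>-related
  to another such union of the same family, so the merged families still witness dimension \<open>n\<close>
  (\<open>cells_separated\<close>). Finally related points have values in a common base element, up to the
  oscillation of \<open>f\<close> on sets of that scale (\<open>related_same_colour\<close>).

  Labels are infinite trees, but there are no more of them than elements of the base. The covers
  are anchored at a point \<open>x0\<close>: on a ball around \<open>x0\<close> that grows with \<open>k\<close>, the \<open>k\<close>-th cover has a
  single member, always with the same label. Every set therefore has only finitely many
  generations of ancestors that carry information (\<open>label_in_labels_of_depth\<close>).

  The smallest \<open>k\<close> for which two points are related, plus 1 if they are distinct, is a metric
  (\<open>scale_dist_triangle\<close>) without values in \<open>(0, 1)\<close>. Composed with a retraction onto no more points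
  than there are labels of scale 0 it separates few classes only, and taking its maximum with
  \<open>min 1 (d (f x) (f y))\<close> adds just enough small-scale structure for \<open>f\<close> itself to factor. The resulting space embeds into the product of a small
  discrete space and \<open>Y\<close>, which bounds its weight (\<open>factor_through_tower\<close>).
\<close>

section \<open>Metric preliminaries\<close>

lemma mdist_self [simp]: "x \<in> mspace X \<Longrightarrow> mdist X x x = 0"
  by simp

lemma mdiameter_le_iff:
  "0 \<le> C \<Longrightarrow> mdiameter X B \<le> ennreal C \<longleftrightarrow> (\<forall>x\<in>B. \<forall>y\<in>B. mdist X x y \<le> C)"
  by (auto simp: mdiameter_def SUP_le_iff ennreal_le_iff)

lemma uniformly_bounded_iff:
  "uniformly_bounded X \<B> \<longleftrightarrow>
     (\<forall>B\<in>\<B>. B \<subseteq> mspace X) \<and> (\<exists>C\<ge>0. \<forall>B\<in>\<B>. \<forall>x\<in>B. \<forall>y\<in>B. mdist X x y \<le> C)"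
proof -
  have "(\<exists>C. \<forall>B\<in>\<B>. mdiameter X B \<le> ennreal C) \<longleftrightarrow> (\<exists>C\<ge>0. \<forall>B\<in>\<B>. mdiameter X B \<le> ennreal C)"
  proof
    assume "\<exists>C. \<forall>B\<in>\<B>. mdiameter X B \<le> ennreal C"
    then obtain C where "\<forall>B\<in>\<B>. mdiameter X B \<le> ennreal C" by blast
    moreover have "ennreal C \<le> ennreal (max 0 C)" by (intro ennreal_leI) simp
    ultimately have "\<forall>B\<in>\<B>. mdiameter X B \<le> ennreal (max 0 C)" by (meson order_trans)
    then show "\<exists>C\<ge>0. \<forall>B\<in>\<B>. mdiameter X B \<le> ennreal C"
      by (intro exI[of _ "max 0 C"]) simp
  qed blast
  also have "\<dots> \<longleftrightarrow> (\<exists>C\<ge>0. \<forall>B\<in>\<B>. \<forall>x\<in>B. \<forall>y\<in>B. mdist X x y \<le> C)"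
    by (simp add: mdiameter_le_iff cong: conj_cong)
  finally show ?thesis
    unfolding uniformly_bounded_def by simp
qed

lemma uniformly_boundedE:
  assumes "uniformly_bounded X \<B>"
  obtains C where "C \<ge> 0" "\<And>B. B \<in> \<B> \<Longrightarrow> B \<subseteq> mspace X"
    "\<And>B x y. B \<in> \<B> \<Longrightarrow> x \<in> B \<Longrightarrow> y \<in> B \<Longrightarrow> mdist X x y \<le> C"
proof -
  have sub: "\<forall>B\<in>\<B>. B \<subseteq> mspace X"
    and bd: "\<exists>C\<ge>0. \<forall>B\<in>\<B>. \<forall>x\<in>B. \<forall>y\<in>B. mdist X x y \<le> C"
    using assms unfolding uniformly_bounded_iff by (rule conjunct1, rule conjunct2)
  from bd obtain C where "C \<ge> 0 \<and> (\<forall>B\<in>\<B>. \<forall>x\<in>B. \<forall>y\<in>B. mdist X x y \<le> C)" ..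
  with sub show thesis by (intro that[of C]) simp_all
qed

text \<open>
  The cover by all balls of radius \<open>R\<close> turns the condition on covers into a modulus of continuity.
\<close>

lemma coarsely_continuous_iff:
  "coarsely_continuous X Y f \<longleftrightarrow>
     f ` mspace X \<subseteq> mspace Y \<and>
     (\<forall>R. \<exists>T\<ge>0. \<forall>x\<in>mspace X. \<forall>y\<in>mspace X. mdist X x y \<le> R \<longrightarrow> mdist Y (f x) (f y) \<le> T)"
    (is "?L \<longleftrightarrow> ?R")
proof
  assume L: ?L
  have "\<exists>T\<ge>0. \<forall>x\<in>mspace X. \<forall>y\<in>mspace X. mdist X x y \<le> R \<longrightarrow> mdist Y (f x) (f y) \<le> T" for R
  proof -
    define R' where "R' = max 0 R"
    let ?B = "(\<lambda>x. mcball_of X x R') ` mspace X"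
    have R': "R' \<ge> 0" by (simp add: R'_def)
    have "uniformly_bounded X ?B"
      unfolding uniformly_bounded_iff
    proof (intro conjI exI[of _ "2 * R'"] ballI)
      fix B y z assume B: "B \<in> ?B" and yz: "y \<in> B" "z \<in> B"
      then obtain x where "y \<in> mcball_of X x R'" "z \<in> mcball_of X x R'" by blast
      then show "mdist X y z \<le> 2 * R'"
        using mdist_triangle[of y X x z] mdist_commute[of X x y] by simp
    qed (use R' in auto)
    moreover have "\<Union>?B = mspace X"
    proof
      show "mspace X \<subseteq> \<Union>?B"
      proof
        fix x assume "x \<in> mspace X"
        moreover from this have "x \<in> mcball_of X x R'" using R' by simp
        ultimately show "x \<in> \<Union>?B" by blast
      qed
    qed auto
    ultimately have "uniformly_bounded Y ((`) f ` ?B)"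
      using L by (simp add: coarsely_continuous_def)
    then obtain T where T: "T \<ge> 0"
      "\<And>B y z. B \<in> (`) f ` ?B \<Longrightarrow> y \<in> B \<Longrightarrow> z \<in> B \<Longrightarrow> mdist Y y z \<le> T"
      by (rule uniformly_boundedE) blast
    have "mdist Y (f x) (f y) \<le> T"
      if xy: "x \<in> mspace X" "y \<in> mspace X" "mdist X x y \<le> R" for x y
    proof (rule T(2))
      show "f ` mcball_of X x R' \<in> (`) f ` ?B" using xy(1) by blast
      show "f x \<in> f ` mcball_of X x R'" "f y \<in> f ` mcball_of X x R'"
        using xy R' by (auto simp: R'_def intro!: imageI)
    qed
    with T(1) show ?thesis by meson
  qed
  moreover have "f ` mspace X \<subseteq> mspace Y"
    using L by (simp add: coarsely_continuous_def)
  ultimately show ?R by simp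
next
  assume R: ?R
  have fX: "f ` mspace X \<subseteq> mspace Y"
    using R by (rule conjunct1)
  have "uniformly_bounded Y ((`) f ` \<B>)" if ub: "uniformly_bounded X \<B>" for \<B>
  proof -
    obtain C where C: "\<And>B. B \<in> \<B> \<Longrightarrow> B \<subseteq> mspace X"
      "\<And>B x y. B \<in> \<B> \<Longrightarrow> x \<in> B \<Longrightarrow> y \<in> B \<Longrightarrow> mdist X x y \<le> C"
      using uniformly_boundedE[OF ub] by metis
    obtain T where T: "T \<ge> 0"
      "\<And>x y. x \<in> mspace X \<Longrightarrow> y \<in> mspace X \<Longrightarrow> mdist X x y \<le> C \<Longrightarrow> mdist Y (f x) (f y) \<le> T"
      using conjunct2[OF R, THEN spec, of C] by (elim exE conjE) simp
    show ?thesis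
      unfolding uniformly_bounded_iff
    proof (intro conjI exI[of _ T] ballI)
      fix B' y z assume "B' \<in> (`) f ` \<B>" "y \<in> B'" "z \<in> B'"
      then obtain B u v where "B \<in> \<B>" "u \<in> B" "v \<in> B" "y = f u" "z = f v" by blast
      then show "mdist Y y z \<le> T" using C(1) by (auto intro!: T(2) C(2))
    next
      fix B' assume "B' \<in> (`) f ` \<B>"
      then obtain B where "B \<in> \<B>" "B' = f ` B" by blast
      then show "B' \<subseteq> mspace Y" using C(1) fX by blast
    qed (rule T(1))
  qed
  then show ?L using fX by (simp add: coarsely_continuous_def)
qed

lemma asdim_le_0_if_bounded:
  assumes "\<And>x y. x \<in> mspace X \<Longrightarrow> y \<in> mspace X \<Longrightarrow> mdist X x y \<le> C"
  shows "asdim_le X 0"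
  unfolding asdim_le_def
proof (intro allI impI exI[of _ "\<lambda>_. {mspace X}"] conjI)
  show "uniformly_bounded X (\<Union>i\<le>(0::nat). {mspace X})"
    unfolding uniformly_bounded_iff
  proof (intro conjI exI[of _ "max 0 C"] ballI)
    fix B x y assume "B \<in> (\<Union>i\<le>(0::nat). {mspace X})" "x \<in> B" "y \<in> B"
    then have "x \<in> mspace X" "y \<in> mspace X" by auto
    then show "mdist X x y \<le> max 0 C" using assms[of x y] by linarith
  qed auto
qed (auto simp: r_disjoint_def)

lemma asdim_le_imp_asdim_le: "asdim_le X n \<Longrightarrow> asdim X \<le> enat n"
  unfolding asdim_def by (rule Inf_lower) blast

lemma asdim_finiteE:
  assumes "asdim X \<noteq> \<infinity>"
  obtains n where "asdim X = enat n" "asdim_le X n"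
proof -
  let ?D = "{enat n | n. asdim_le X n}"
  have D: "?D \<noteq> {}"
    using assms by (metis Inf_enat_def asdim_def)
  then obtain m where "m \<in> ?D" by blast
  then have "(LEAST m. m \<in> ?D) \<in> ?D" by (rule LeastI)
  then have "Inf ?D \<in> ?D" using D unfolding Inf_enat_def by simp
  then show thesis using that by (auto simp: asdim_def)
qed

lemma openin_mtopology_of_iff:
  "openin (mtopology_of X) U \<longleftrightarrow>
     U \<subseteq> mspace X \<and> (\<forall>x\<in>U. \<exists>r>0. \<forall>y\<in>mspace X. mdist X x y < r \<longrightarrow> y \<in> U)"
proof -
  interpret Metric_space "mspace X" "mdist X" by simp
  show ?thesis
  proof (cases "U \<subseteq> mspace X")
    case True
    then have "mball x r \<subseteq> U \<longleftrightarrow> (\<forall>y\<in>mspace X. mdist X x y < r \<longrightarrow> y \<in> U)" if "x \<in> U" for x r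
      using that True unfolding mball_def by blast
    with True show ?thesis
      unfolding mtopology_of_def openin_mtopology by auto
  qed (simp add: mtopology_of_def openin_mtopology)
qed

section \<open>Bases and the weight\<close>

lemma image_ordLeq: "|A| \<le>o \<kappa> \<Longrightarrow> |f ` A| \<le>o \<kappa>"
  by (rule ordLeq_transitive[OF card_of_image])

lemma subset_ordLeq: "A \<subseteq> B \<Longrightarrow> |B| \<le>o \<kappa> \<Longrightarrow> |A| \<le>o \<kappa>"
  by (rule ordLeq_transitive[OF card_of_mono1])

lemma base_of_iff:
  "base_of T \<B> \<longleftrightarrow>
     (\<forall>V\<in>\<B>. openin T V) \<and> (\<forall>U x. openin T U \<and> x \<in> U \<longrightarrow> (\<exists>V\<in>\<B>. x \<in> V \<and> V \<subseteq> U))"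
  unfolding base_of_def openin_topology_base_unique by blast

lemma weight_le_base:
  assumes "base_of (mtopology_of X) \<B>"
  shows "weight X \<le>o |\<B>|"
  using weight_attained[of X] assms by auto

lemma base_point_in_ball:
  assumes K: "base_of (mtopology_of Y) K" and y: "y \<in> mspace Y" and e: "e > 0"
  obtains B where "B \<in> K" "y \<in> B" "B \<subseteq> mball_of Y y e"
proof -
  have "openin (mtopology_of Y) (mball_of Y y e)"
    unfolding mtopology_of_def mball_of_def
    by (simp add: Metric_space.openin_mball)
  with that show thesis
    using K y e unfolding base_of_iff by (metis Metric_space.centre_in_mball_iff Metric_space_mspace_mdist mball_of_def)
qed

lemma infinite_base:
  assumes K: "base_of (mtopology_of Y) K" and inf: "infinite (mspace Y)"
  shows "infinite K"
proof
  assume "finite K"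
  have "inj_on (\<lambda>y. {B\<in>K. y \<in> B}) (mspace Y)"
  proof (rule inj_onI)
    fix y z assume yz: "y \<in> mspace Y" "z \<in> mspace Y" "{B\<in>K. y \<in> B} = {B\<in>K. z \<in> B}"
    show "y = z"
    proof (rule ccontr)
      assume "y \<noteq> z"
      then have "mdist Y y z > 0"
        using yz by (metis mdist_nonneg mdist_zero order_le_less)
      then obtain B where "B \<in> K" "y \<in> B" "B \<subseteq> mball_of Y y (mdist Y y z)"
        using base_point_in_ball[OF K yz(1)] by blast
      then show False using yz by auto
    qed
  qed
  moreover have "(\<lambda>y. {B\<in>K. y \<in> B}) ` mspace Y \<subseteq> Pow K" by auto
  ultimately have "finite (mspace Y)"
    using \<open>finite K\<close> by (meson finite_Pow_iff inj_on_finite)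
  with inf show False by simp
qed

text \<open>
  The hypotheses say that \<open>z \<mapsto> (q z, f z)\<close> is an embedding into the product of a discrete space
  with \<open>Y\<close>; the traces of the boxes \<open>{a} \<times> B\<close> are then a base of \<open>Z\<close>.
\<close>

lemma weight_le_if_embeds_in_discrete_times:
  fixes Z :: "'a metric" and Y :: "'b metric" and q :: "'a \<Rightarrow> 'c" and f :: "'a \<Rightarrow> 'b"
  assumes K: "base_of (mtopology_of Y) K" and f: "f ` mspace Z \<subseteq> mspace Y"
    and cont: "\<And>z e. z \<in> mspace Z \<Longrightarrow> e > 0 \<Longrightarrow>
      \<exists>\<delta>>0. \<forall>y\<in>mspace Z. mdist Z z y < \<delta> \<longrightarrow> q y = q z \<and> mdist Y (f z) (f y) < e"
    and emb: "\<And>z e. z \<in> mspace Z \<Longrightarrow> e > 0 \<Longrightarrow>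
      \<exists>\<delta>>0. \<forall>y\<in>mspace Z. q y = q z \<and> mdist Y (f z) (f y) < \<delta> \<longrightarrow> mdist Z z y < e"
  shows "weight Z \<le>o |(q ` mspace Z) \<times> K|"
proof -
  define P where "P = (\<lambda>(a, B). {z \<in> mspace Z. q z = a \<and> f z \<in> B})"
  have "base_of (mtopology_of Z) (P ` (q ` mspace Z \<times> K))"
    unfolding base_of_iff
  proof (intro conjI ballI allI impI)
    fix V assume "V \<in> P ` (q ` mspace Z \<times> K)"
    then obtain a B where V: "V = {z \<in> mspace Z. q z = a \<and> f z \<in> B}" and "B \<in> K"
      by (auto simp: P_def)
    then have oB: "openin (mtopology_of Y) B" using K by (auto simp: base_of_iff)
    show "openin (mtopology_of Z) V"
      unfolding openin_mtopology_of_iff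
    proof (intro conjI ballI)
      fix z assume z: "z \<in> V"
      then obtain e where e: "e > 0" "\<And>y. y \<in> mspace Y \<Longrightarrow> mdist Y (f z) y < e \<Longrightarrow> y \<in> B"
        using oB V unfolding openin_mtopology_of_iff by blast
      have "z \<in> mspace Z" using z V by auto
      from cont[OF this e(1)] show "\<exists>r>0. \<forall>y\<in>mspace Z. mdist Z z y < r \<longrightarrow> y \<in> V"
        using e(2) z V f by blast
    qed (use V in auto)
  next
    fix U z assume U: "openin (mtopology_of Z) U \<and> z \<in> U"
    then obtain e where e: "e > 0" "\<And>y. y \<in> mspace Z \<Longrightarrow> mdist Z z y < e \<Longrightarrow> y \<in> U"
      and z: "z \<in> mspace Z"
      unfolding openin_mtopology_of_iff by blast
    obtain \<delta> where \<delta>: "\<delta> > 0"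
      "\<And>y. y \<in> mspace Z \<Longrightarrow> q y = q z \<Longrightarrow> mdist Y (f z) (f y) < \<delta> \<Longrightarrow> mdist Z z y < e"
      using emb[OF z e(1)] by blast
    obtain B where B: "B \<in> K" "f z \<in> B" "B \<subseteq> mball_of Y (f z) \<delta>"
      using base_point_in_ball[OF K _ \<delta>(1), of "f z"] z f by blast
    have "P (q z, B) \<subseteq> U"
      using B e(2) \<delta>(2) by (auto simp: P_def subset_iff)
    moreover have "z \<in> P (q z, B)" using z B by (simp add: P_def)
    ultimately show "\<exists>V\<in>P ` (q ` mspace Z \<times> K). z \<in> V \<and> V \<subseteq> U"
      using z B(1) by blast
  qed
  from weight_le_base[OF this] show ?thesis
    by (rule ordLeq_transitive) (rule card_of_image)
qed

section \<open>Quotients of pseudometrics\<close>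

text \<open>
  The quotient is realised on a set of representatives, so that it is again a metric space over
  the type of the points of \<open>M\<close>.
\<close>

lemma pseudometric_quotient:
  fixes d :: "'a \<Rightarrow> 'a \<Rightarrow> real"
  assumes nonneg: "\<And>x y. 0 \<le> d x y" and sym: "\<And>x y. d x y = d y x"
    and refl: "\<And>x. x \<in> M \<Longrightarrow> d x x = 0"
    and tri: "\<And>x y z. x \<in> M \<Longrightarrow> y \<in> M \<Longrightarrow> z \<in> M \<Longrightarrow> d x z \<le> d x y + d y z"
  obtains Z g where "mspace Z = g ` M" "g ` M \<subseteq> M" "\<forall>x\<in>M. d x (g x) = 0"
    "mdist Z = d"
proof -
  define g where "g x = (SOME y. y \<in> M \<and> d x y = 0)" for x
  have g: "g x \<in> M \<and> d x (g x) = 0" if "x \<in> M" for x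
  proof -
    have "\<exists>y. y \<in> M \<and> d x y = 0" using that refl by blast
    then show ?thesis unfolding g_def by (rule someI_ex)
  qed
  have g_eq: "g x = g y" if xy: "x \<in> M" "y \<in> M" "d x y = 0" for x y
  proof -
    have "d x z = 0 \<longleftrightarrow> d y z = 0" if "z \<in> M" for z
      using tri[OF xy(1,2) that] tri[OF xy(2,1) that] nonneg[of x z] nonneg[of y z] sym[of x y] xy(3)
      by linarith
    then have "(\<lambda>z. z \<in> M \<and> d x z = 0) = (\<lambda>z. z \<in> M \<and> d y z = 0)" by auto
    then show ?thesis by (simp add: g_def)
  qed
  have "Metric_space (g ` M) d"
  proof
    fix x y assume "x \<in> g ` M" "y \<in> g ` M"
    then obtain a b where ab: "a \<in> M" "b \<in> M" "x = g a" "y = g b" by auto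
    show "d x y = 0 \<longleftrightarrow> x = y"
    proof
      assume "d x y = 0"
      moreover have "d a x = 0" "d y b = 0" "x \<in> M" "y \<in> M"
        using ab g[OF ab(1)] g[OF ab(2)] sym[of y b] by simp_all
      ultimately have "d a b \<le> 0"
        using tri[OF ab(1) \<open>x \<in> M\<close> ab(2)] tri[OF \<open>x \<in> M\<close> \<open>y \<in> M\<close> ab(2)] by linarith
      then have "d a b = 0" using nonneg[of a b] by linarith
      then show "x = y" using ab g_eq by simp
    qed (use ab g refl in simp)
  next
    fix x y z assume "x \<in> g ` M" "y \<in> g ` M" "z \<in> g ` M"
    then have "x \<in> M" "y \<in> M" "z \<in> M" using g by blast+
    then show "d x z \<le> d x y + d y z" by (rule tri)
  qed (rule nonneg sym)+
  then have "mspace (metric (g ` M, d)) = g ` M" "mdist (metric (g ` M, d)) = d"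
    by (simp_all add: Metric_space.mspace_metric Metric_space.mdist_metric)
  then show thesis using g by (intro that[of "metric (g ` M, d)" g]) auto
qed

text \<open>
  For an increasing sequence of relations with \<open>E k \<circ> E k \<subseteq> E (k + 1)\<close>, the index at which two
  points become related satisfies \<open>d x z \<le> max (d x y) (d y z) + 1\<close>. Adding 1 off the diagonal
  makes all nonzero values at least 1, and then \<open>max a b + 1 \<le> a + b\<close> gives the triangle
  inequality without a passage to chains.
\<close>

definition scale_dist :: "(nat \<Rightarrow> 'a \<Rightarrow> 'a \<Rightarrow> bool) \<Rightarrow> 'a \<Rightarrow> 'a \<Rightarrow> real" where
  "scale_dist E x y = (if x = y then 0 else 1 + real (LEAST k. E k x y))"

lemma scale_dist_nonneg: "0 \<le> scale_dist E x y"
  by (simp add: scale_dist_def)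

lemma scale_dist_le: "E k x y \<Longrightarrow> scale_dist E x y \<le> 1 + real k"
  by (auto simp: scale_dist_def intro: Least_le)

lemma scale_dist_triangle:
  assumes mono: "\<And>k l x y. E k x y \<Longrightarrow> k \<le> l \<Longrightarrow> E l x y"
    and comp: "\<And>k x y z. E k x y \<Longrightarrow> E k y z \<Longrightarrow> E (Suc k) x z"
    and ex: "E i x y" "E j y z"
  shows "scale_dist E x z \<le> scale_dist E x y + scale_dist E y z"
proof (cases "x = y \<or> y = z \<or> x = z")
  case True
  then show ?thesis using scale_dist_nonneg[of E] by (auto simp: scale_dist_def)
next
  case False
  define k l where "k = (LEAST k. E k x y)" and "l = (LEAST k. E k y z)"
  have "E k x y" unfolding k_def by (rule LeastI[where P = "\<lambda>k. E k x y", OF ex(1)])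
  moreover have "E l y z" unfolding l_def by (rule LeastI[where P = "\<lambda>k. E k y z", OF ex(2)])
  ultimately have "E (max k l) x y" "E (max k l) y z"
    by (blast intro: mono max.cobounded1 max.cobounded2)+
  then have "E (Suc (max k l)) x z" by (rule comp)
  then have "scale_dist E x z \<le> 1 + real (Suc (max k l))" by (rule scale_dist_le)
  also have "\<dots> \<le> scale_dist E x y + scale_dist E y z"
    using False by (auto simp: scale_dist_def k_def l_def)
  finally show ?thesis .
qed

lemma scale_dist_leD:
  assumes "scale_dist E x y \<le> real k" "E i x y"
    and mono: "\<And>k l x y. E k x y \<Longrightarrow> k \<le> l \<Longrightarrow> E l x y"
    and refl: "\<And>k. E k x x"
  shows "E k x y"
proof (cases "x = y")
  case False
  have "E (LEAST k. E k x y) x y" by (rule LeastI[where P = "\<lambda>k. E k x y", OF assms(2)])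
  moreover have "(LEAST k. E k x y) \<le> k" using assms(1) False by (simp add: scale_dist_def)
  ultimately show ?thesis by (rule mono)
qed (use refl in simp)

section \<open>Anchored covers\<close>

text \<open>
  The predicate describes one scale: \<open>n + 1\<close> families \<open>U i\<close> of pairwise disjoint sets of diameter
  at most \<open>S\<close>, with Lebesgue number \<open>r\<close>, such that the anchor \<open>b\<close> is the only member of any family that
  meets the ball of radius \<open>r\<close> about \<open>x0\<close>.
\<close>

definition anchored_cover ::
  "'a metric \<Rightarrow> nat \<Rightarrow> 'a \<Rightarrow> real \<Rightarrow> (nat \<Rightarrow> 'a set set) \<Rightarrow> 'a set \<Rightarrow> real \<Rightarrow> bool" where
  "anchored_cover X n x0 r U b S \<longleftrightarrow> 0 < r \<and> 0 \<le> S \<and>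
     (\<forall>i. \<forall>A\<in>U i. i \<le> n \<and> A \<subseteq> mspace X \<and> A \<noteq> {} \<and> (\<forall>x\<in>A. \<forall>y\<in>A. mdist X x y \<le> S)) \<and>
     (\<forall>i. \<forall>A\<in>U i. \<forall>B\<in>U i. A \<inter> B \<noteq> {} \<longrightarrow> A = B) \<and>
     (\<forall>x\<in>mspace X. \<exists>i. \<exists>A\<in>U i. mball_of X x r \<subseteq> A) \<and>
     b \<in> U 0 \<and> mball_of X x0 r \<subseteq> b \<and>
     (\<forall>i. \<forall>A\<in>U i. A \<inter> mball_of X x0 r \<noteq> {} \<longrightarrow> i = 0 \<and> A = b)"

text \<open>
  Families that are \<open>2 r\<close>-disjoint stay disjoint when their members are enlarged to their open
  \<open>r\<close>-neighbourhoods, which have Lebesgue number \<open>r\<close>. The anchor is a ball \<open>D\<close> about \<open>x0\<close> together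
  with the sets of family 0 that meet it. Since \<open>D\<close> is larger by the mesh \<open>T\<close> than the ball of
  radius \<open>r\<close>, it contains all sets of the other families that meet the small ball. Those can be
  dropped without loss to the Lebesgue number, whereas cutting the small ball out of them would
  lower it.
\<close>

lemma anchored_cover_exists:
  assumes dim: "asdim_le X n" and x0: "x0 \<in> mspace X" and r: "r > 0"
  shows "\<exists>U b S. anchored_cover X n x0 r U b S"
proof -
  obtain F :: "nat \<Rightarrow> 'a set set" where ub: "uniformly_bounded X (\<Union>i\<le>n. F i)"
    and cov: "\<Union>(\<Union>i\<le>n. F i) = mspace X" and dis: "\<And>i. i \<le> n \<Longrightarrow> r_disjoint X (2 * r) (F i)"
    using dim[unfolded asdim_le_def, rule_format, of "2 * r"] r by auto
  obtain C where C: "C \<ge> 0" "\<And>i A. i \<le> n \<Longrightarrow> A \<in> F i \<Longrightarrow> A \<subseteq> mspace X"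
    "\<And>i A x y. i \<le> n \<Longrightarrow> A \<in> F i \<Longrightarrow> x \<in> A \<Longrightarrow> y \<in> A \<Longrightarrow> mdist X x y \<le> C"
    by (rule uniformly_boundedE[OF ub]) blast
  define N where "N A = {y \<in> mspace X. \<exists>a\<in>A. mdist X a y < r}" for A
  define V where "V i = (if i \<le> n then N ` (F i - {{}}) else {})" for i
  define T where "T = C + 2 * r"
  have T: "T > 0" using C(1) r by (simp add: T_def)
  have V_sub: "A \<subseteq> mspace X" if "A \<in> V i" for A i
    using that by (auto simp: V_def N_def split: if_splits)
  have V_le: "i \<le> n" if "A \<in> V i" for A i
    using that by (auto simp: V_def split: if_splits)
  have V_ne: "A \<noteq> {}" if A: "A \<in> V i" for A i
  proof -
    obtain A' a where "A = N A'" "A' \<in> F i" "a \<in> A'" "i \<le> n"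
      using A by (auto simp: V_def split: if_splits)
    moreover from this have "a \<in> N A'" using C(2) r by (force simp: N_def)
    ultimately show ?thesis by blast
  qed
  have V_bd: "mdist X x y \<le> T" if A: "A \<in> V i" "x \<in> A" "y \<in> A" for A i x y
  proof -
    obtain A' where A': "A = N A'" "A' \<in> F i" "i \<le> n"
      using A(1) by (auto simp: V_def split: if_splits)
    obtain a b where ab: "a \<in> A'" "b \<in> A'" "mdist X a x < r" "mdist X b y < r"
      and xy: "x \<in> mspace X" "y \<in> mspace X"
      using A A'(1) by (auto simp: N_def)
    have m: "a \<in> mspace X" "b \<in> mspace X" using ab A' C(2) by blast+
    have "mdist X x y \<le> mdist X x a + mdist X a b + mdist X b y"
      using mdist_triangle[OF xy(1) m(1) xy(2)] mdist_triangle[OF m(1) m(2) xy(2)] by linarith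
    then show ?thesis
      using ab C(3)[OF A'(3,2) ab(1,2)] by (simp add: T_def mdist_commute)
  qed
  have V_dis: "A = B" if V: "A \<in> V i" "B \<in> V i" "x \<in> A" "x \<in> B" for A B i x
  proof -
    obtain A' B' where AB: "A = N A'" "A' \<in> F i" "B = N B'" "B' \<in> F i" "i \<le> n"
      using V(1,2) by (auto simp: V_def split: if_splits)
    obtain a b where ab: "a \<in> A'" "b \<in> B'" "mdist X a x < r" "mdist X b x < r" "x \<in> mspace X"
      using V(3,4) AB by (auto simp: N_def)
    have m: "a \<in> mspace X" "b \<in> mspace X" using ab AB C(2) by blast+
    have "mdist X a b < 2 * r"
      using mdist_triangle[OF m(1) ab(5) m(2)] ab(3,4) by (simp add: mdist_commute)
    then have "A' = B'" using dis[OF AB(5)] AB ab by (force simp: r_disjoint_def)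
    then show ?thesis using AB by simp
  qed
  have V_leb: "\<exists>i. \<exists>A\<in>V i. mball_of X x r \<subseteq> A" if x: "x \<in> mspace X" for x
  proof -
    obtain i A where iA: "i \<le> n" "A \<in> F i" "x \<in> A" using cov x by blast
    then have "N A \<in> V i" by (auto simp: V_def)
    moreover have "mball_of X x r \<subseteq> N A" using iA by (auto simp: N_def)
    ultimately show ?thesis by blast
  qed
  define D where "D = mball_of X x0 (r + T)"
  define b where "b = D \<union> \<Union>{A \<in> V 0. A \<inter> D \<noteq> {}}"
  define U where "U i = (if i = 0 then insert b {A \<in> V 0. A \<inter> D = {}}
                         else {A \<in> V i. A \<inter> mball_of X x0 r = {}})" for i
  have ball_D: "mball_of X x0 r \<subseteq> D" using T by (auto simp: D_def)
  have x0_D: "x0 \<in> D" using x0 r T by (simp add: D_def)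
  have near: "A \<subseteq> D" if A: "A \<in> V i" "A \<inter> mball_of X x0 r \<noteq> {}" for A i
  proof
    fix y assume y: "y \<in> A"
    obtain p where p: "p \<in> A" "mdist X x0 p < r" "p \<in> mspace X" using A(2) by auto
    have "y \<in> mspace X" using V_sub A y by blast
    then show "y \<in> D"
      using mdist_triangle[OF x0 p(3), of y] V_bd[OF A(1) p(1) y] p(2) x0 by (simp add: D_def)
  qed
  have b_sub: "b \<subseteq> mspace X" using V_sub by (auto simp: b_def D_def)
  have b_ne: "b \<noteq> {}" using x0_D by (auto simp: b_def)
  have b_near: "mdist X x0 y \<le> r + 2 * T" if yb: "y \<in> b" for y
  proof (cases "y \<in> D")
    case True
    then show ?thesis using T by (simp add: D_def)
  next
    case False
    then obtain A p where A: "A \<in> V 0" "y \<in> A" "p \<in> A" "p \<in> D"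
      using yb by (auto simp: b_def)
    then have "y \<in> mspace X" using V_sub by blast
    then show ?thesis
      using mdist_triangle[OF x0, of p y] V_bd[OF A(1,3,2)] A(4) by (simp add: D_def)
  qed
  have b_bd: "mdist X x y \<le> 2 * (r + 2 * T)" if "x \<in> b" "y \<in> b" for x y
    using mdist_triangle[of x X x0 y] x0 subsetD[OF b_sub] that b_near[of x] b_near[of y]
      mdist_commute[of X x x0] by simp
  have "anchored_cover X n x0 r U b (2 * (r + 2 * T))"
    unfolding anchored_cover_def
  proof (intro conjI allI ballI impI)
    show "0 < r" "0 \<le> 2 * (r + 2 * T)" using r T by auto
    show "b \<in> U 0" by (simp add: U_def)
    show "mball_of X x0 r \<subseteq> b" using ball_D by (auto simp: b_def)
    fix i A assume A: "A \<in> U i"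
    then have A_cases: "i = 0 \<and> A = b \<or> A \<in> V i" by (auto simp: U_def split: if_splits)
    show "i \<le> n" "A \<subseteq> mspace X" "A \<noteq> {}"
      using A_cases V_le[of A i] V_sub[of A i] V_ne[of A i] b_sub b_ne by blast+
    show "mdist X x y \<le> 2 * (r + 2 * T)" if "x \<in> A" "y \<in> A" for x y
      using A_cases
    proof
      assume "A \<in> V i"
      then show ?thesis using V_bd[of A i x y] that T r by simp
    qed (use that b_bd in auto)
    show "A = B" if "B \<in> U i" "A \<inter> B \<noteq> {}" for B
    proof -
      have B_b: "B' \<inter> b = {}" if "B' \<in> V 0" "B' \<inter> D = {}" for B'
        using that V_dis[of B' 0] by (fastforce simp: b_def)
      show ?thesis
        using A \<open>B \<in> U i\<close> \<open>A \<inter> B \<noteq> {}\<close> B_b V_dis[of A i B]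
        by (auto simp: U_def split: if_splits)
    qed
    assume "A \<inter> mball_of X x0 r \<noteq> {}"
    then show "i = 0" "A = b"
      using A ball_D by (auto simp: U_def split: if_splits)
  next
    fix x assume "x \<in> mspace X"
    then obtain i A where A: "A \<in> V i" "mball_of X x r \<subseteq> A" using V_leb by blast
    show "\<exists>i. \<exists>A\<in>U i. mball_of X x r \<subseteq> A"
    proof (cases "A \<in> U i")
      case False
      have "A \<subseteq> b"
      proof (cases "i = 0")
        case True
        then show ?thesis using False A by (auto simp: U_def b_def)
      next
        case i: False
        then have "A \<subseteq> D" using False A near[of A i] by (auto simp: U_def)
        then show ?thesis by (auto simp: b_def)
      qed
      moreover have "b \<in> U 0" by (simp add: U_def)
      ultimately show ?thesis using A(2) by blast
    qed (use A in blast)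
  qed
  then show ?thesis by blast
qed

section \<open>Towers of covers and their labels\<close>

text \<open>
  The growth condition puts the anchor and every set of scale \<open>k\<close> inside a ball that is not
  split by the cover of scale \<open>k + 1\<close>, and it makes the anchors exhaust the space. \<open>C\<close> is an
  arbitrary colouring of the points.
\<close>

locale anchored_tower =
  fixes X :: "'a metric" and n :: nat and x0 :: 'a
    and U :: "nat \<Rightarrow> nat \<Rightarrow> 'a set set" and b :: "nat \<Rightarrow> 'a set"
    and S r :: "nat \<Rightarrow> real" and C :: "'a \<Rightarrow> 'c"
  assumes x0: "x0 \<in> mspace X"
    and cover: "\<And>k. anchored_cover X n x0 (r k) (U k) (b k) (S k)"
    and grow: "\<And>k. S k + real k + 1 < r (Suc k)"
begin

lemma r_pos: "0 < r k" and S_nonneg: "0 \<le> S k"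
  and anchor: "b k \<in> U k 0" "mball_of X x0 (r k) \<subseteq> b k"
  using cover[of k, unfolded anchored_cover_def] by simp_all

lemma member:
  assumes "A \<in> U k i"
  shows "i \<le> n" "A \<subseteq> mspace X" "A \<noteq> {}" "x \<in> A \<Longrightarrow> y \<in> A \<Longrightarrow> mdist X x y \<le> S k"
proof -
  have "\<forall>i. \<forall>A\<in>U k i. i \<le> n \<and> A \<subseteq> mspace X \<and> A \<noteq> {} \<and> (\<forall>x\<in>A. \<forall>y\<in>A. mdist X x y \<le> S k)"
    using cover[of k, unfolded anchored_cover_def] by (elim conjE)
  from this[rule_format, OF assms]
  show "i \<le> n" "A \<subseteq> mspace X" "A \<noteq> {}" "x \<in> A \<Longrightarrow> y \<in> A \<Longrightarrow> mdist X x y \<le> S k"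
    by simp_all
qed

lemma disjoint:
  assumes "A \<in> U k i" "B \<in> U k i" "x \<in> A" "x \<in> B"
  shows "A = B"
proof -
  have "\<forall>i. \<forall>A\<in>U k i. \<forall>B\<in>U k i. A \<inter> B \<noteq> {} \<longrightarrow> A = B"
    using cover[of k, unfolded anchored_cover_def] by (elim conjE)
  from this[rule_format, OF assms(1,2)] assms(3,4) show ?thesis by blast
qed

lemma lebesgue:
  assumes "x \<in> mspace X"
  obtains i A where "A \<in> U k i" "mball_of X x (r k) \<subseteq> A"
proof -
  have "\<forall>x\<in>mspace X. \<exists>i. \<exists>A\<in>U k i. mball_of X x (r k) \<subseteq> A"
    using cover[of k, unfolded anchored_cover_def] by (elim conjE)
  from this[rule_format, OF assms] that show thesis by blast
qed

lemma anchor_unique: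
  assumes "A \<in> U k i" "x \<in> A" "x \<in> mball_of X x0 (r k)"
  shows "i = 0 \<and> A = b k"
proof -
  have "\<forall>i. \<forall>A\<in>U k i. A \<inter> mball_of X x0 (r k) \<noteq> {} \<longrightarrow> i = 0 \<and> A = b k"
    using cover[of k, unfolded anchored_cover_def] by (elim conjE)
  from this[rule_format, OF assms(1)] assms(2,3) show ?thesis by blast
qed

lemma r_ge: "real k \<le> r k"
proof (cases k)
  case (Suc j)
  then show ?thesis using grow[of j] S_nonneg[of j] by simp
qed (use r_pos[of k] in simp)

lemma x0_ball: "x0 \<in> mball_of X x0 (r k)"
  using x0 r_pos by simp

lemma member_subset_ball:
  assumes "A \<in> U k i" "x \<in> A"
  shows "A \<subseteq> mball_of X x (r (Suc k))"
proof
  fix y assume "y \<in> A"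
  then have "mdist X x y \<le> S k" using member(4)[OF assms(1)] assms(2) by blast
  then show "y \<in> mball_of X x (r (Suc k))"
    using grow[of k] member(2)[OF assms(1)] assms(2) \<open>y \<in> A\<close> by auto
qed

text \<open>
  By disjointness the union has at most one term, so \<open>parent k A i\<close> is the member of the \<open>i\<close>-th
  family of scale \<open>k + 1\<close> that contains \<open>A\<close>, and the empty set if there is none. The empty set
  has no parents but itself.
\<close>

definition parent :: "nat \<Rightarrow> 'a set \<Rightarrow> nat \<Rightarrow> 'a set" where
  "parent k A i = \<Union>{B \<in> U (Suc k) i. A \<noteq> {} \<and> A \<subseteq> B}"

lemma parent_eq:
  assumes "A \<noteq> {}" "B \<in> U (Suc k) i" "A \<subseteq> B"
  shows "parent k A i = B"
proof -
  have "{B \<in> U (Suc k) i. A \<noteq> {} \<and> A \<subseteq> B} = {B}"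
    using assms disjoint[of _ "Suc k" i B] by blast
  then show ?thesis by (simp add: parent_def)
qed

lemma parent_nonempty:
  assumes "parent k A i \<noteq> {}"
  shows "A \<noteq> {}" "A \<subseteq> parent k A i" "parent k A i \<in> U (Suc k) i"
proof -
  obtain B where "B \<in> U (Suc k) i" "A \<noteq> {}" "A \<subseteq> B"
    using assms by (auto simp: parent_def)
  then show "A \<noteq> {}" "A \<subseteq> parent k A i" "parent k A i \<in> U (Suc k) i"
    using parent_eq by auto
qed

lemma parent_anchor: "parent k (b k) i = (if i = 0 then b (Suc k) else {})"
proof -
  have x0b: "x0 \<in> b k" for k using anchor(2)[of k] x0_ball[of k] by blast
  have sub: "b k \<subseteq> b (Suc k)"
    using member_subset_ball[OF anchor(1) x0b] anchor(2) by blast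
  show ?thesis
  proof (cases "i = 0")
    case True
    then show ?thesis using parent_eq[OF _ anchor(1) sub] x0b by auto
  next
    case False
    have "parent k (b k) i = {}"
    proof (rule ccontr)
      assume "parent k (b k) i \<noteq> {}"
      from parent_nonempty[OF this] show False
        using anchor_unique[of _ "Suc k" i x0] x0b x0_ball False by blast
    qed
    with False show ?thesis by simp
  qed
qed

primrec ancestor :: "nat list \<Rightarrow> nat \<Rightarrow> 'a set \<Rightarrow> 'a set" where
  "ancestor [] k A = A"
| "ancestor (i # is) k A = ancestor is (Suc k) (parent k A i)"

text \<open>
  The preference for \<open>x0\<close> gives all anchors the same colour.
\<close>

definition pt :: "'a set \<Rightarrow> 'a" where
  "pt A = (if x0 \<in> A then x0 else (SOME x. x \<in> A))"

lemma pt_in: "A \<noteq> {} \<Longrightarrow> pt A \<in> A"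
  by (auto simp: pt_def some_in_eq)

definition colour :: "'a set \<Rightarrow> 'c option" where
  "colour A = (if A = {} then None else Some (C (pt A)))"

text \<open>
  A node of the tree of ancestors is addressed by the list of the families that lead to it.
  Ancestors that do not exist get \<open>None\<close>, hence a label shows which parents exist.
\<close>

definition label :: "nat \<Rightarrow> 'a set \<Rightarrow> nat list \<Rightarrow> 'c option" where
  "label k A is = colour (ancestor is k A)"

lemma label_Nil: "label k A [] = colour A"
  and label_Cons: "label k A (i # is) = label (Suc k) (parent k A i) is"
  by (simp_all add: label_def)

lemma label_parent_cong:
  assumes "label k A = label k B"
  shows "label (Suc k) (parent k A i) = label (Suc k) (parent k B i)"
  using fun_cong[OF assms, of "i # _"] by (auto simp: label_Cons)

lemma colour_cong: "label k A = label k B \<Longrightarrow> colour A = colour B"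
  by (metis label_Nil)

lemma label_empty_cong: "label k A = label k B \<Longrightarrow> A = {} \<longleftrightarrow> B = {}"
  by (drule colour_cong) (simp add: colour_def split: if_splits)

definition related :: "nat \<Rightarrow> 'a \<Rightarrow> 'a \<Rightarrow> bool" where
  "related k x y \<longleftrightarrow> (\<exists>i j. \<exists>A\<in>U k i. \<exists>B\<in>U k j. x \<in> A \<and> y \<in> B \<and> label k A = label k B)"

lemma related_in: "related k x y \<Longrightarrow> x \<in> mspace X \<and> y \<in> mspace X"
  unfolding related_def using member(2) by blast

lemma related_sym: "related k x y \<Longrightarrow> related k y x"
  unfolding related_def by metis

lemma related_if_close:
  assumes "x \<in> mspace X" "y \<in> mspace X" "mdist X x y < r k"
  shows "related k x y"
proof -
  obtain i A where "A \<in> U k i" "mball_of X x (r k) \<subseteq> A" by (rule lebesgue[OF assms(1)])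
  moreover have "x \<in> mball_of X x (r k)" "y \<in> mball_of X x (r k)" using assms r_pos by auto
  ultimately show ?thesis unfolding related_def by blast
qed

lemma related_refl: "x \<in> mspace X \<Longrightarrow> related k x x"
  by (rule related_if_close) (auto simp: r_pos)

text \<open>
  Let \<open>x \<in> A1\<close>, \<open>y \<in> A2 \<inter> A3\<close> and \<open>z \<in> A4\<close> with \<open>A1\<close>, \<open>A2\<close> and likewise \<open>A3\<close>, \<open>A4\<close> of equal labels.
  Some \<open>W\<close> of scale \<open>k + 1\<close> contains a ball about \<open>y\<close> and with it \<open>A2\<close> and \<open>A3\<close>. The parents of
  \<open>A1\<close> and \<open>A4\<close> in the family of \<open>W\<close> have the label of \<open>W\<close>; in particular they exist.
\<close>

lemma related_comp:
  assumes "related k x y" "related k y z"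
  shows "related (Suc k) x z"
proof -
  obtain A1 A2 i1 i2 where A: "A1 \<in> U k i1" "A2 \<in> U k i2" "x \<in> A1" "y \<in> A2"
    "label k A1 = label k A2" using assms(1) unfolding related_def by blast
  obtain A3 A4 i3 i4 where A': "A3 \<in> U k i3" "A4 \<in> U k i4" "y \<in> A3" "z \<in> A4"
    "label k A3 = label k A4" using assms(2) unfolding related_def by blast
  obtain i W where W: "W \<in> U (Suc k) i" "mball_of X y (r (Suc k)) \<subseteq> W"
    using related_in[OF assms(1)] lebesgue[of y "Suc k"] by metis
  have "A2 \<subseteq> W" "A3 \<subseteq> W"
    using member_subset_ball[OF A(2,4)] member_subset_ball[OF A'(1,3)] W(2) by blast+
  then have p: "parent k A2 i = W" "parent k A3 i = W"
    using parent_eq[OF _ W(1)] A(4) A'(3) by auto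
  have l: "label (Suc k) (parent k A1 i) = label (Suc k) W"
    "label (Suc k) (parent k A4 i) = label (Suc k) W"
    using label_parent_cong[OF A(5), of i] label_parent_cong[OF A'(5), of i] p by auto
  then have "parent k A1 i \<noteq> {}" "parent k A4 i \<noteq> {}"
    using label_empty_cong member(3)[OF W(1)] by blast+
  from parent_nonempty(2,3)[OF this(1)] parent_nonempty(2,3)[OF this(2)] l A(3) A'(4)
  show ?thesis unfolding related_def by (metis subsetD)
qed

lemma related_mono:
  assumes xy: "related k x y" and "k \<le> l"
  shows "related l x y"
  using \<open>k \<le> l\<close>
proof (induction l rule: dec_induct)
  case (step l)
  then show ?case using related_comp related_refl related_in[OF xy] by blast
qed (rule xy)

lemma related_bounded:
  "\<exists>k. \<forall>x\<in>mspace X. \<forall>y\<in>mspace X. mdist X x y \<le> R \<longrightarrow> related k x y"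
proof -
  obtain k where "R < real k" using reals_Archimedean2 by blast
  then have "R < r k" using r_ge[of k] by simp
  then show ?thesis using related_if_close by (meson order_le_less_trans)
qed

lemma related_ex: "x \<in> mspace X \<Longrightarrow> y \<in> mspace X \<Longrightarrow> \<exists>k. related k x y"
  using related_bounded[of "mdist X x y"] by blast

lemma related_same_colour:
  assumes "related k x y"
  shows "\<exists>p\<in>mspace X. \<exists>q\<in>mspace X. mdist X x p \<le> S k \<and> mdist X y q \<le> S k \<and> C p = C q"
proof -
  obtain A B i j where A: "A \<in> U k i" "B \<in> U k j" "x \<in> A" "y \<in> B" "label k A = label k B"
    using assms unfolding related_def by blast
  have "colour A = colour B" by (rule colour_cong[OF A(5)])
  then have "C (pt A) = C (pt B)" using A(3,4) by (auto simp: colour_def split: if_splits)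
  moreover have "pt A \<in> A" "pt B \<in> B" using A(3,4) pt_in by auto
  ultimately show ?thesis using A member(2,4) by (meson subsetD)
qed

text \<open>
  Each set is shrunk to the points whose \<open>r k\<close>-ball it contains. This loses no points of the cover
  and ensures that a set of scale \<open>k - 1\<close> touching the shrunken set lies in the original one.
\<close>

definition cell :: "nat \<Rightarrow> nat \<Rightarrow> (nat list \<Rightarrow> 'c option) \<Rightarrow> 'a set" where
  "cell k i v = {x \<in> mspace X. \<exists>A\<in>U k i. mball_of X x (r k) \<subseteq> A \<and> label k A = v}"

lemma cells_cover: "x \<in> mspace X \<Longrightarrow> \<exists>i\<le>n. \<exists>v. x \<in> cell k i v"
  by (rule lebesgue[of x k]) (auto simp: cell_def dest: member(1))

lemma cell_in: "x \<in> cell k i v \<Longrightarrow> x \<in> mspace X"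
  by (simp add: cell_def)

lemma cellE:
  assumes "x \<in> cell k i v"
  obtains A where "A \<in> U k i" "mball_of X x (r k) \<subseteq> A" "label k A = v" "x \<in> A"
proof -
  have "x \<in> mball_of X x (r k)" using cell_in[OF assms] r_pos by simp
  with assms that show thesis unfolding cell_def by blast
qed

lemma cell_related:
  assumes "x \<in> cell k i v" "y \<in> cell k i v"
  shows "related k x y"
proof -
  obtain A where "A \<in> U k i" "label k A = v" "x \<in> A" by (rule cellE[OF assms(1)])
  moreover obtain B where "B \<in> U k i" "label k B = v" "y \<in> B" by (rule cellE[OF assms(2)])
  ultimately show ?thesis unfolding related_def by metis
qed

text \<open>
  Sets \<open>A \<ni> x\<close> and \<open>B \<ni> y\<close> of scale \<open>k\<close> with equal labels lie in the sets \<open>V\<close>, \<open>W\<close> of family \<open>i\<close>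
  that define the two cells. So \<open>V\<close> and \<open>W\<close> are their \<open>i\<close>-th parents, which have equal labels.
\<close>

lemma cells_separated:
  assumes x: "x \<in> cell (Suc k) i v" and y: "y \<in> cell (Suc k) i w" and xy: "related k x y"
  shows "v = w"
proof -
  obtain A B a b where A: "A \<in> U k a" "B \<in> U k b" "x \<in> A" "y \<in> B" "label k A = label k B"
    using xy unfolding related_def by blast
  obtain V where V: "V \<in> U (Suc k) i" "mball_of X x (r (Suc k)) \<subseteq> V" "label (Suc k) V = v"
    by (rule cellE[OF x])
  obtain W where W: "W \<in> U (Suc k) i" "mball_of X y (r (Suc k)) \<subseteq> W" "label (Suc k) W = w"
    by (rule cellE[OF y])
  have "A \<subseteq> V" "B \<subseteq> W"
    using member_subset_ball[OF A(1,3)] member_subset_ball[OF A(2,4)] V(2) W(2) by blast+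
  then have "parent k A i = V" "parent k B i = W"
    using parent_eq V(1) W(1) A(3,4) by blast+
  then show ?thesis using label_parent_cong[OF A(5), of i] V(3) W(3) by simp
qed

end

section \<open>Counting labels\<close>

lemma finite_ordLeq_infinite: "finite A \<Longrightarrow> infinite K \<Longrightarrow> |A| \<le>o |K|"
  by (meson card_of_Well_order card_of_ordLeq_finite ordLeq_total)

lemma Times_ordLeq:
  "infinite K \<Longrightarrow> |A| \<le>o |K| \<Longrightarrow> |B| \<le>o |K| \<Longrightarrow> |A \<times> B| \<le>o |K|"
  by (rule card_of_Times_ordLeq_infinite_Field) (simp_all add: Field_card_of card_of_card_order_on)

lemma Un_ordLeq:
  "infinite K \<Longrightarrow> |A| \<le>o |K| \<Longrightarrow> |B| \<le>o |K| \<Longrightarrow> |A \<union> B| \<le>o |K|"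
  by (rule card_of_Un_ordLeq_infinite_Field) (simp_all add: Field_card_of card_of_card_order_on)

lemma card_of_lists_of_length:
  assumes "infinite K" "|L| \<le>o |K|"
  shows "|{ls. set ls \<subseteq> L \<and> length ls = m}| \<le>o |K|"
proof (induction m)
  case 0
  show ?case by (rule finite_ordLeq_infinite) (simp_all add: assms(1))
next
  case (Suc m)
  have "{ls. set ls \<subseteq> L \<and> length ls = Suc m} \<subseteq>
      (\<lambda>(a, ls). a # ls) ` (L \<times> {ls. set ls \<subseteq> L \<and> length ls = m})"
    by (auto simp: length_Suc_conv image_iff)
  then show ?case
    by (rule subset_ordLeq[OF _ image_ordLeq[OF Times_ordLeq[OF assms(1,2) Suc]]])
qed

text \<open>
  A label is determined by its root colour and the labels of its \<open>n + 1\<close> parents; \<open>node\<close> puts these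
  together again.
\<close>

definition node :: "nat \<Rightarrow> 'c option \<Rightarrow> (nat list \<Rightarrow> 'c option) list \<Rightarrow> nat list \<Rightarrow> 'c option" where
  "node n v ls is = (case is of [] \<Rightarrow> v | i # js \<Rightarrow> if i \<le> n then (ls ! i) js else None)"

text \<open>
  The labels of depth 0 are those of the empty set and of the anchors (\<open>label_empty\<close> and
  \<open>label_anchor\<close> below).
\<close>

fun labels_of_depth :: "nat \<Rightarrow> 'c \<Rightarrow> 'c set \<Rightarrow> nat \<Rightarrow> (nat list \<Rightarrow> 'c option) set" where
  "labels_of_depth n c D 0 = {\<lambda>_. None, \<lambda>is. if set is \<subseteq> {0} then Some c else None}"
| "labels_of_depth n c D (Suc m) = labels_of_depth n c D 0 \<union>
     (\<lambda>(v, ls). node n v ls) `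
       (insert None (Some ` D) \<times> {ls. set ls \<subseteq> labels_of_depth n c D m \<and> length ls = Suc n})"

lemma card_of_labels_of_depth:
  assumes K: "infinite K" and D: "|D| \<le>o |K|"
  shows "|labels_of_depth n c D m| \<le>o |K|"
proof (induction m)
  case 0
  show ?case by (rule finite_ordLeq_infinite) (simp_all add: K)
next
  case (Suc m)
  have "|insert None (Some ` D)| \<le>o |K|"
    using Un_ordLeq[OF K finite_ordLeq_infinite[of "{None}"]
        image_ordLeq[OF D]] K by simp
  from Times_ordLeq[OF K this card_of_lists_of_length[OF K Suc]]
  have "|(\<lambda>(v, ls). node n v ls) ` (insert None (Some ` D) \<times>
      {ls. set ls \<subseteq> labels_of_depth n c D m \<and> length ls = Suc n})| \<le>o |K|"
    by (rule image_ordLeq)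
  moreover have "|labels_of_depth n c D 0| \<le>o |K|"
    by (rule finite_ordLeq_infinite) (simp_all add: K)
  ultimately show ?case
    unfolding labels_of_depth.simps(2) by (intro Un_ordLeq[OF K])
qed

context anchored_tower
begin

lemma label_empty: "label k {} = (\<lambda>_. None)"
proof
  fix "is"
  show "label k {} is = None"
  proof (induction "is" arbitrary: k)
    case (Cons i "is")
    then show ?case by (simp add: label_Cons parent_def)
  qed (simp add: label_Nil colour_def)
qed

lemma label_anchor: "label k (b k) = (\<lambda>is. if set is \<subseteq> {0} then Some (C x0) else None)"
proof
  fix "is"
  show "label k (b k) is = (if set is \<subseteq> {0} then Some (C x0) else None)"
  proof (induction "is" arbitrary: k)
    case Nil
    have "x0 \<in> b k" using anchor(2)[of k] x0_ball[of k] by blast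
    then show ?case by (auto simp: label_Nil colour_def pt_def)
  next
    case (Cons i "is")
    then show ?case by (auto simp: label_Cons parent_anchor label_empty)
  qed
qed

text \<open>
  All nonempty ancestors of \<open>A\<close> contain a given point \<open>x\<close> of \<open>A\<close>. After \<open>m\<close> generations \<open>x\<close> lies in
  the ball on which only the anchor lives, so each ancestor is an anchor or empty.
\<close>

lemma label_in_labels_of_depth:
  assumes "A = {} \<or> (\<exists>i. A \<in> U k i) \<and> x \<in> A" "x \<in> mspace X" "mdist X x0 x < r (k + m)"
  shows "label k A \<in> labels_of_depth n (C x0) (C ` mspace X) m"
  using assms
proof (induction m arbitrary: k A)
  case 0
  show ?case
  proof (cases "A = {}")
    case False
    then obtain i where "A \<in> U k i" "x \<in> A" using 0(1) by blast
    moreover have "x \<in> mball_of X x0 (r k)" using 0(2,3) x0 by simp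
    ultimately have "A = b k" using anchor_unique by blast
    then show ?thesis by (simp add: label_anchor)
  qed (simp add: label_empty)
next
  case (Suc m)
  show ?case
  proof (cases "A = {}")
    case False
    let ?ls = "map (\<lambda>i. label (Suc k) (parent k A i)) [0..<Suc n]"
    have "label k A is = node n (colour A) ?ls is" for "is"
    proof (cases "is")
      case (Cons i js)
      have "parent k A i = {}" if "\<not> i \<le> n"
        using that parent_nonempty(3) member(1) by blast
      with Cons show ?thesis
        by (auto simp: label_Cons node_def label_empty nth_append less_Suc_eq_le simp del: upt_Suc)
    qed (simp add: label_Nil node_def)
    then have eq: "label k A = (\<lambda>(v, ls). node n v ls) (colour A, ?ls)" by (simp add: fun_eq_iff)
    have "label (Suc k) (parent k A i) \<in> labels_of_depth n (C x0) (C ` mspace X) m" for i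
    proof (rule Suc.IH)
      show "parent k A i = {} \<or> (\<exists>j. parent k A i \<in> U (Suc k) j) \<and> x \<in> parent k A i"
        using parent_nonempty[of k A i] Suc.prems(1) by blast
    qed (use Suc.prems in auto)
    then have "set ?ls \<subseteq> labels_of_depth n (C x0) (C ` mspace X) m" "length ?ls = Suc n"
      by (auto simp del: upt_Suc)
    moreover have "colour A \<in> insert None (Some ` C ` mspace X)"
    proof -
      have "pt A \<in> mspace X" using Suc.prems(1) False pt_in[OF False] member(2) by blast
      then show ?thesis by (simp add: colour_def)
    qed
    ultimately show ?thesis
      unfolding eq labels_of_depth.simps(2) by (intro UnI2 imageI) simp
  qed (simp add: label_empty)
qed

lemma card_of_labels:
  assumes K: "infinite K" and D: "|C ` mspace X| \<le>o |K|"
  shows "|{label k A | A i. A \<in> U k i}| \<le>o |K|"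
proof -
  have "{label k A | A i. A \<in> U k i} \<subseteq> (\<Union>m. labels_of_depth n (C x0) (C ` mspace X) m)"
  proof
    fix v assume "v \<in> {label k A | A i. A \<in> U k i}"
    then obtain A i where v: "v = label k A" and A: "A \<in> U k i" by blast
    obtain x where x: "x \<in> A" "x \<in> mspace X" using member(2,3)[OF A] by blast
    obtain m where "mdist X x0 x < real m" using reals_Archimedean2 by blast
    then have "mdist X x0 x < r (k + m)" using r_ge[of "k + m"] by simp
    then have "label k A \<in> labels_of_depth n (C x0) (C ` mspace X) m"
      using A x by (intro label_in_labels_of_depth[of A k x m]) blast+
    then show "v \<in> (\<Union>m. labels_of_depth n (C x0) (C ` mspace X) m)"
      using v by blast
  qed
  moreover have "|\<Union>m. labels_of_depth n (C x0) (C ` mspace X) m| \<le>o |K|"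
    using K card_of_labels_of_depth[OF K D]
    by (intro card_of_UNION_ordLeq_infinite ballI) (simp_all add: infinite_iff_card_of_nat)
  ultimately show ?thesis by (rule subset_ordLeq)
qed

text \<open>
  Choose a set of scale 0 around each point, and one point for each label that occurs.
\<close>

lemma small_retraction:
  assumes K: "infinite K" and D: "|C ` mspace X| \<le>o |K|"
  obtains q where "|q ` mspace X| \<le>o |K|" "\<And>x. x \<in> mspace X \<Longrightarrow> related 0 x (q x)"
proof -
  have "\<exists>A. (\<exists>i. A \<in> U 0 i) \<and> x \<in> A" if x: "x \<in> mspace X" for x
  proof -
    obtain i A where "A \<in> U 0 i" "mball_of X x (r 0) \<subseteq> A" by (rule lebesgue[OF x])
    moreover have "x \<in> mball_of X x (r 0)" using x r_pos by simp
    ultimately show ?thesis by blast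
  qed
  then obtain A where A: "\<And>x. x \<in> mspace X \<Longrightarrow> (\<exists>i. A x \<in> U 0 i) \<and> x \<in> A x"
    by metis
  define l where "l x = label 0 (A x)" for x
  define q where "q x = inv_into (mspace X) l (l x)" for x
  have q: "q x \<in> mspace X" "l (q x) = l x" if "x \<in> mspace X" for x
    using that unfolding q_def by (simp_all add: inv_into_into f_inv_into_f)
  have "l ` mspace X \<subseteq> {label 0 A | A i. A \<in> U 0 i}"
    using A by (auto simp: l_def)
  then have "|l ` mspace X| \<le>o |K|"
    using card_of_labels[OF K D, of 0] by (rule subset_ordLeq)
  moreover have "q ` mspace X = inv_into (mspace X) l ` l ` mspace X"
    by (auto simp: q_def)
  ultimately have "|q ` mspace X| \<le>o |K|"
    using image_ordLeq by metis
  moreover have "related 0 x (q x)" if "x \<in> mspace X" for x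
    using q[OF that] A[OF that] A[of "q x"] unfolding related_def l_def by metis
  ultimately show thesis by (rule that)
qed

end

lemma anchored_tower_exists:
  assumes dim: "asdim_le X n" and x0: "x0 \<in> mspace X"
  obtains U b S r where "anchored_tower X n x0 U b S r"
proof -
  define P where "P x \<longleftrightarrow> anchored_cover X n x0 (fst x) (fst (snd x)) (fst (snd (snd x))) (snd (snd (snd x)))"
    for x :: "real \<times> (nat \<Rightarrow> 'a set set) \<times> 'a set \<times> real"
  have ex: "\<exists>x. P x \<and> fst x = \<rho>" if \<rho>: "\<rho> > 0" for \<rho>
  proof -
    obtain U b S where "anchored_cover X n x0 \<rho> U b S"
      using anchored_cover_exists[OF dim x0 \<rho>] by (elim exE)
    then have "P (\<rho>, U, b, S)" by (simp add: P_def)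
    then show ?thesis by (intro exI[of _ "(\<rho>, U, b, S)"]) simp
  qed
  have "\<exists>F. \<forall>k. P (F k) \<and> snd (snd (snd (F k))) + real k + 1 < fst (F (Suc k))"
  proof (rule dependent_nat_choice)
    show "\<exists>x. P x" using ex[OF zero_less_one] by auto
  next
    fix x k assume "P x"
    let ?S = "snd (snd (snd x))"
    have "?S \<ge> 0" using \<open>P x\<close> unfolding P_def anchored_cover_def by (elim conjE)
    then have "?S + real k + 2 > 0" by simp
    from ex[OF this] obtain y where "P y \<and> fst y = ?S + real k + 2" ..
    then show "\<exists>y. P y \<and> ?S + real k + 1 < fst y"
      by (intro exI[of _ y]) simp
  qed
  then obtain F
    where "\<forall>k. P (F k) \<and> snd (snd (snd (F k))) + real k + 1 < fst (F (Suc k))" ..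
  then have F: "P (F k)" "snd (snd (snd (F k))) + real k + 1 < fst (F (Suc k))" for k
    by simp_all
  have "anchored_tower X n x0 (\<lambda>k. fst (snd (F k))) (\<lambda>k. fst (snd (snd (F k))))
      (\<lambda>k. snd (snd (snd (F k)))) (\<lambda>k. fst (F k))"
    by (rule anchored_tower.intro) (use x0 F in \<open>simp_all add: P_def\<close>)
  then show thesis by (rule that)
qed

section \<open>The factorization\<close>

text \<open>
  Points of \<open>X\<close> with the same value are identified, which realises \<open>f X\<close> over the type of the points
  of \<open>X\<close>.
\<close>

lemma factor_through_image:
  assumes f: "coarsely_continuous X Y f"
  obtains Z :: "'a metric" and g :: "'a \<Rightarrow> 'a"
  where "coarsely_continuous X Z g" "coarsely_continuous Z Y f"
    "\<And>x. x \<in> mspace X \<Longrightarrow> f x = f (g x)" "weight Z \<le>o weight Y"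
    "finite (f ` mspace X) \<Longrightarrow> asdim_le Z 0"
proof -
  have fX: "f x \<in> mspace Y" if "x \<in> mspace X" for x
    using f that by (auto simp: coarsely_continuous_def)
  define d where "d x y = mdist Y (f x) (f y)" for x y
  have "0 \<le> d x y" "d x y = d y x" for x y by (simp_all add: d_def mdist_commute)
  moreover have "d x x = 0" if "x \<in> mspace X" for x using fX[OF that] by (simp add: d_def)
  moreover have "d x z \<le> d x y + d y z"
    if "x \<in> mspace X" "y \<in> mspace X" "z \<in> mspace X" for x y z
    unfolding d_def using that by (intro mdist_triangle fX)
  ultimately obtain Z g where Z: "mspace Z = g ` mspace X" "g ` mspace X \<subseteq> mspace X"
    "\<forall>x\<in>mspace X. d x (g x) = 0" "mdist Z = d"
    by (rule pseudometric_quotient)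
  have gX: "g x \<in> mspace X" if "x \<in> mspace X" for x using Z(2) that by blast
  have ZX: "z \<in> mspace X" if "z \<in> mspace Z" for z using Z(1,2) that by blast
  have dZ: "mdist Z x y = mdist Y (f x) (f y)" for x y
    by (simp add: Z(4) d_def)
  have fg: "f x = f (g x)" if "x \<in> mspace X" for x
    using bspec[OF Z(3) that] fX[OF that] fX[OF gX[OF that]] by (simp add: d_def)
  have fZ: "f ` mspace Z \<subseteq> mspace Y" using ZX fX by blast
  obtain K where K: "base_of (mtopology_of Y) K" "weight Y = |K|"
    using weight_attained[of Y] by blast
  show thesis
  proof (rule that)
    show "f x = f (g x)" if "x \<in> mspace X" for x using fg that .
    have "mdist Z (g x) (g y) = mdist Y (f x) (f y)" if "x \<in> mspace X" "y \<in> mspace X" for x y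
      using that dZ[of "g x" "g y"] fg by simp
    then show "coarsely_continuous X Z g"
      using f unfolding coarsely_continuous_iff by (simp add: Z(1))
    show "coarsely_continuous Z Y f"
      unfolding coarsely_continuous_iff
    proof (intro conjI allI)
      fix R :: real
      show "\<exists>T\<ge>0. \<forall>x\<in>mspace Z. \<forall>y\<in>mspace Z. mdist Z x y \<le> R \<longrightarrow> mdist Y (f x) (f y) \<le> T"
        by (intro exI[of _ "max 0 R"]) (auto simp: dZ)
    qed (rule fZ)
    show "asdim_le Z 0" if fin: "finite (f ` mspace X)"
    proof (rule asdim_le_0_if_bounded)
      fix x y assume xy: "x \<in> mspace Z" "y \<in> mspace Z"
      let ?D = "(\<lambda>(a, b). mdist Y a b) ` (f ` mspace X \<times> f ` mspace X)"
      have "finite ?D" using fin by blast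
      moreover have "mdist Y (f x) (f y) \<in> ?D" using ZX xy by force
      ultimately show "mdist Z x y \<le> Max ?D" using dZ by simp
    qed
    have "weight Z \<le>o |((\<lambda>_. ()) ` mspace Z) \<times> K|"
    proof (rule weight_le_if_embeds_in_discrete_times[OF K(1) fZ])
      fix z e assume z: "z \<in> mspace Z" and e: "(e::real) > 0"
      show "\<exists>\<delta>>0. \<forall>y\<in>mspace Z. mdist Z z y < \<delta> \<longrightarrow> () = () \<and> mdist Y (f z) (f y) < e"
        "\<exists>\<delta>>0. \<forall>y\<in>mspace Z. () = () \<and> mdist Y (f z) (f y) < \<delta> \<longrightarrow> mdist Z z y < e"
        using e dZ by (intro exI[of _ e]; simp)+
    qed
    also have "|((\<lambda>_. ()) ` mspace Z) \<times> K| \<le>o |Pair () ` K|"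
      by (intro card_of_mono1) auto
    also have "|Pair () ` K| \<le>o |K|" by (rule card_of_image)
    finally show "weight Z \<le>o weight Y" using K(2) by simp
  qed
qed

text \<open>
  The coarse part of the metric of \<open>Z\<close> is computed after the retraction \<open>q\<close> onto few points. It
  moves points only within the relation of scale 0, at the cost of two scales in each direction
  (\<open>to_q\<close>, \<open>from_q\<close>).
\<close>

lemma factor_through_tower:
  fixes X :: "'a metric" and Y :: "'b metric" and f :: "'a \<Rightarrow> 'b"
  assumes f: "coarsely_continuous X Y f" and dim: "asdim_le X n"
    and x0: "x0 \<in> mspace X" and inf: "infinite (mspace Y)"
  obtains Z :: "'a metric" and g :: "'a \<Rightarrow> 'a"
  where "coarsely_continuous X Z g" "coarsely_continuous Z Y f"
    "\<And>x. x \<in> mspace X \<Longrightarrow> f x = f (g x)" "asdim_le Z n" "weight Z \<le>o weight Y"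
proof -
  have fX: "f x \<in> mspace Y" if "x \<in> mspace X" for x
    using f that by (auto simp: coarsely_continuous_def)
  \<comment> \<open>A base of minimal size bounds the number of labels, and the product base below.\<close>
  obtain K where K: "base_of (mtopology_of Y) K" "weight Y = |K|"
    using weight_attained[of Y] by blast
  have infK: "infinite K" by (rule infinite_base[OF K(1) inf])
  have "\<exists>B\<in>K. f x \<in> B \<and> B \<subseteq> mball_of Y (f x) 1" if "x \<in> mspace X" for x
    by (rule base_point_in_ball[OF K(1) fX[OF that] zero_less_one]) blast
  then have "\<forall>x. \<exists>B. x \<in> mspace X \<longrightarrow> B \<in> K \<and> f x \<in> B \<and> B \<subseteq> mball_of Y (f x) 1"
    by blast
  then obtain C where "\<forall>x. x \<in> mspace X \<longrightarrow> C x \<in> K \<and> f x \<in> C x \<and> C x \<subseteq> mball_of Y (f x) 1"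
    by (rule choice[THEN exE])
  then have C: "C x \<in> K" "f x \<in> C x" "C x \<subseteq> mball_of Y (f x) 1" if "x \<in> mspace X" for x
    using that by simp_all
  have C_close: "mdist Y (f p) (f p') \<le> 1" if "p \<in> mspace X" "p' \<in> mspace X" "C p = C p'" for p p'
  proof -
    have "f p' \<in> mball_of Y (f p) 1" using C(3)[OF that(1)] C(2)[OF that(2)] that(3) by auto
    then show ?thesis by simp
  qed
  obtain U b S r where "anchored_tower X n x0 U b S r"
    using anchored_tower_exists[OF dim x0] by blast
  then interpret anchored_tower X n x0 U b S r C .
  have "|C ` mspace X| \<le>o |K|" using C(1) by (intro card_of_mono1) auto
  then obtain q where q: "|q ` mspace X| \<le>o |K|" "\<And>x. x \<in> mspace X \<Longrightarrow> related 0 x (q x)"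
    using small_retraction[OF infK] by blast
  have qX: "q x \<in> mspace X" if "x \<in> mspace X" for x
    using related_in q(2) that by blast
  have to_q: "related (k + 2) (q x) (q y)" if xy: "related k x y" for k x y
  proof -
    have "related k (q x) x" "related k y (q y)"
      using q(2) related_in[OF that] related_mono related_sym by blast+
    then have "related (Suc (Suc k)) (q x) (q y)"
      using that related_comp related_mono by (meson le_SucI le_refl)
    then show ?thesis by simp
  qed
  have from_q: "related (k + 2) x y"
    if "related k (q x) (q y)" "x \<in> mspace X" "y \<in> mspace X" for k x y
  proof -
    have "related k x (q x)" "related k (q y) y"
      using q(2) that(2,3) related_mono related_sym by blast+
    then have "related (Suc (Suc k)) x y"
      using that related_comp related_mono by (meson le_SucI le_refl)
    then show ?thesis by simp
  qed
  \<comment> \<open>The relations are made reflexive outside the carrier as well, as the distance expects.\<close>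
  define R where "R k x y \<longleftrightarrow> x = y \<or> related k x y" for k x y
  have R_mono: "R l x y" if "R k x y" "k \<le> l" for k l x y
    using that related_mono by (auto simp: R_def)
  have R_comp: "R (Suc k) x z" if "R k x y" "R k y z" for k x y z
    using that related_comp related_mono[of k _ _ "Suc k"] by (auto simp: R_def)
  have R_ex: "\<exists>k. R k x y" if "x \<in> mspace X" "y \<in> mspace X" for x y
    using related_ex[OF that] by (auto simp: R_def)
  have R_sym: "R k x y \<longleftrightarrow> R k y x" for k x y
    using related_sym by (auto simp: R_def)
  \<comment> \<open>Distances below 1 can occur only within a class of \<open>q\<close>, and there they come from \<open>Y\<close>.\<close>
  define d where "d x y = max (scale_dist R (q x) (q y)) (min 1 (mdist Y (f x) (f y)))"
    for x y
  have d_le: "d x y \<le> real k + 3" if "related k x y" for k x y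
    using scale_dist_le[of R "k + 2" "q x" "q y"] to_q[OF that] by (simp add: d_def R_def)
  have d_leD: "related (k + 2) x y" if "d x y \<le> real k" "x \<in> mspace X" "y \<in> mspace X" for k x y
  proof -
    obtain i where "R i (q x) (q y)" using R_ex qX \<open>x \<in> mspace X\<close> \<open>y \<in> mspace X\<close> by blast
    then have "R k (q x) (q y)"
      using scale_dist_leD[of R "q x" "q y" k i] that(1) R_mono by (auto simp: d_def R_def)
    then have "related k (q x) (q y)"
      using related_refl[OF qX[OF that(2)], of k] by (auto simp: R_def)
    then show ?thesis by (rule from_q) (use that in auto)
  qed
  have d_nonneg: "0 \<le> d x y" for x y
    by (simp add: d_def scale_dist_nonneg le_max_iff_disj)
  have d_sym: "d x y = d y x" for x y
  proof -
    have "scale_dist R x y = scale_dist R y x" for x y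
      unfolding scale_dist_def by (subst R_sym) auto
    then show ?thesis unfolding d_def by (simp add: mdist_commute)
  qed
  have d_refl: "d x x = 0" if "x \<in> mspace X" for x
    using fX[OF that] by (simp add: d_def scale_dist_def)
  have d_triangle: "d x z \<le> d x y + d y z"
    if xyz: "x \<in> mspace X" "y \<in> mspace X" "z \<in> mspace X" for x y z
  proof -
    obtain i where i: "R i (q x) (q y)" using R_ex[OF qX[OF xyz(1)] qX[OF xyz(2)]] ..
    obtain j where j: "R j (q y) (q z)" using R_ex[OF qX[OF xyz(2)] qX[OF xyz(3)]] ..
    have "scale_dist R (q x) (q z) \<le> scale_dist R (q x) (q y) + scale_dist R (q y) (q z)"
      using R_mono R_comp i j by (rule scale_dist_triangle)
    moreover have "mdist Y (f x) (f z) \<le> mdist Y (f x) (f y) + mdist Y (f y) (f z)"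
      using xyz by (intro mdist_triangle fX)
    moreover have "0 \<le> mdist Y (f x) (f y)" "0 \<le> mdist Y (f y) (f z)" by simp_all
    ultimately show ?thesis
      unfolding d_def by linarith
  qed
  obtain Z g where Z: "mspace Z = g ` mspace X" "g ` mspace X \<subseteq> mspace X"
    "\<forall>x\<in>mspace X. d x (g x) = 0" "mdist Z = d"
    using d_nonneg d_sym d_refl d_triangle by (rule pseudometric_quotient)
  have gX: "g x \<in> mspace X" if "x \<in> mspace X" for x using Z(2) that by blast
  have ZX: "z \<in> mspace X" if "z \<in> mspace Z" for z using Z(1,2) that by blast
  have fg: "f x = f (g x)" if x: "x \<in> mspace X" for x
  proof -
    have "mdist Y (f x) (f (g x)) = 0"
      using bspec[OF Z(3) x] mdist_nonneg[of Y "f x" "f (g x)"] unfolding d_def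
      by (auto simp: max_def min_def split: if_splits)
    then show ?thesis using fX gX x by simp
  qed
  show thesis
  proof (rule that)
    show "f x = f (g x)" if "x \<in> mspace X" for x using fg that .
    show "coarsely_continuous X Z g"
      unfolding coarsely_continuous_iff
    proof (intro conjI allI)
      fix Rad
      obtain k where k: "\<And>x y. x \<in> mspace X \<Longrightarrow> y \<in> mspace X \<Longrightarrow> mdist X x y \<le> Rad \<Longrightarrow> related k x y"
        using related_bounded[of Rad] by blast
      have g0: "related 2 x (g x)" if "x \<in> mspace X" for x
        using d_leD[of x "g x" 0] Z(3) gX that by (simp add: numeral_2_eq_2)
      have "d (g x) (g y) \<le> real (k + 4) + 3"
        if xy: "x \<in> mspace X" "y \<in> mspace X" "mdist X x y \<le> Rad" for x y
      proof (rule d_le)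
        have "related (k + 2) (g x) x" "related (k + 2) x y" "related (k + 2) y (g y)"
          using g0[OF xy(1)] g0[OF xy(2)] k[OF xy] related_mono related_sym by (meson le_add1 le_add2)+
        then have "related (Suc (Suc (k + 2))) (g x) (g y)"
          using related_comp related_mono by (meson le_SucI le_refl)
        then show "related (k + 4) (g x) (g y)" by (simp add: numeral_eq_Suc)
      qed
      then show "\<exists>T\<ge>0. \<forall>x\<in>mspace X. \<forall>y\<in>mspace X. mdist X x y \<le> Rad \<longrightarrow> mdist Z (g x) (g y) \<le> T"
        unfolding Z(4) by (intro exI[of _ "real (k + 4) + 3"]) auto
    qed (simp add: Z(1))
    show "coarsely_continuous Z Y f"
      unfolding coarsely_continuous_iff
    proof (intro conjI allI)
      show "f ` mspace Z \<subseteq> mspace Y" using ZX fX by blast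
      fix Rad :: real
      obtain k where k: "Rad \<le> real k" using real_arch_simple by blast
      obtain T where T: "T \<ge> 0" "\<And>x y. x \<in> mspace X \<Longrightarrow> y \<in> mspace X \<Longrightarrow> mdist X x y \<le> S (k + 2)
          \<Longrightarrow> mdist Y (f x) (f y) \<le> T"
        using f unfolding coarsely_continuous_iff by meson
      have "mdist Y (f x) (f y) \<le> 2 * T + 1"
        if "x \<in> mspace X" "y \<in> mspace X" "d x y \<le> Rad" for x y
      proof -
        have "related (k + 2) x y" using d_leD that k by simp
        then obtain p p' where p: "p \<in> mspace X" "p' \<in> mspace X" "mdist X x p \<le> S (k + 2)"
          "mdist X y p' \<le> S (k + 2)" "C p = C p'"
          using related_same_colour by blast
        have "mdist Y (f x) (f y) \<le> mdist Y (f x) (f p) + mdist Y (f p) (f y)"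
          "mdist Y (f p) (f y) \<le> mdist Y (f p) (f p') + mdist Y (f p') (f y)"
          using that p by (simp_all add: mdist_triangle fX)
        moreover have "mdist Y (f x) (f p) \<le> T" "mdist Y (f p') (f y) \<le> T"
          using T(2)[of x p] T(2)[of p' y] that p by (simp_all add: mdist_commute)
        moreover have "mdist Y (f p) (f p') \<le> 1" using p by (intro C_close)
        ultimately show ?thesis by linarith
      qed
      then show "\<exists>T\<ge>0. \<forall>x\<in>mspace Z. \<forall>y\<in>mspace Z. mdist Z x y \<le> Rad \<longrightarrow> mdist Y (f x) (f y) \<le> T"
        unfolding Z(4) using T(1) ZX by (intro exI[of _ "2 * T + 1"]) auto
    qed
    show "asdim_le Z n"
      unfolding asdim_le_def
    proof (intro allI impI)
      fix s :: real assume "s > 0"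
      obtain m where m: "s \<le> real m" using real_arch_simple by blast
      \<comment> \<open>A distance below \<open>m\<close> means relatedness on scale \<open>m + 2\<close>; cells one scale up are separated.\<close>
      define F where "F i = (\<lambda>v. cell (m + 3) i v \<inter> mspace Z) ` UNIV" for i
      have bd: "uniformly_bounded Z (\<Union>i\<le>n. F i)"
        unfolding uniformly_bounded_iff Z(4)
      proof (intro conjI exI[of _ "real (m + 3) + 3"])
        show "\<forall>B\<in>\<Union>i\<le>n. F i. \<forall>x\<in>B. \<forall>y\<in>B. d x y \<le> real (m + 3) + 3"
          unfolding F_def using d_le[OF cell_related] by blast
      qed (auto simp: F_def)
      have cov: "\<Union>(\<Union>i\<le>n. F i) = mspace Z"
      proof
        show "mspace Z \<subseteq> \<Union>(\<Union>i\<le>n. F i)"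
        proof
          fix z assume z: "z \<in> mspace Z"
          obtain i v where "i \<le> n" "z \<in> cell (m + 3) i v"
            using cells_cover[OF ZX[OF z]] by blast
          with z show "z \<in> \<Union>(\<Union>i\<le>n. F i)" by (auto simp: F_def)
        qed
      qed (auto simp: F_def)
      have dis: "r_disjoint Z s (F i)" for i
        unfolding r_disjoint_def Z(4)
      proof (intro ballI impI)
        fix A B x y assume AB: "A \<in> F i" "B \<in> F i" "A \<noteq> B" and xy: "x \<in> A" "y \<in> B"
        obtain v w where v: "A = cell (m + 3) i v \<inter> mspace Z" "B = cell (m + 3) i w \<inter> mspace Z"
          using AB by (auto simp: F_def)
        show "s \<le> d x y"
        proof (rule ccontr)
          assume "\<not> s \<le> d x y"
          then have "related (m + 2) x y" using d_leD[of x y m] m v xy ZX by simp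
          moreover have "x \<in> cell (Suc (m + 2)) i v" "y \<in> cell (Suc (m + 2)) i w"
            using v xy by (simp_all add: numeral_eq_Suc)
          ultimately have "v = w" using cells_separated by blast
          with v AB(3) show False by simp
        qed
      qed
      show "\<exists>\<F>. uniformly_bounded Z (\<Union>i\<le>n. \<F> i) \<and> \<Union>(\<Union>i\<le>n. \<F> i) = mspace Z \<and>
          (\<forall>i\<le>n. r_disjoint Z s (\<F> i))"
        using bd cov dis by (intro exI[of _ F]) simp
    qed
    have "weight Z \<le>o |(q ` mspace Z) \<times> K|"
    proof (rule weight_le_if_embeds_in_discrete_times[OF K(1)])
      show "f ` mspace Z \<subseteq> mspace Y" using ZX fX by blast
      fix z e assume z: "z \<in> mspace Z" and e: "(e::real) > 0"
      show "\<exists>\<delta>>0. \<forall>y\<in>mspace Z. mdist Z z y < \<delta> \<longrightarrow> q y = q z \<and> mdist Y (f z) (f y) < e"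
      proof (intro exI[of _ "min 1 e"] conjI ballI impI)
        fix y assume y: "y \<in> mspace Z" and zy: "mdist Z z y < min 1 e"
        then have "scale_dist R (q z) (q y) < 1" "min 1 (mdist Y (f z) (f y)) < min 1 e"
          unfolding Z(4) d_def by simp_all
        then show "q y = q z" "mdist Y (f z) (f y) < e"
          by (auto simp: scale_dist_def split: if_splits)
      qed (use e in simp)
      show "\<exists>\<delta>>0. \<forall>y\<in>mspace Z. q y = q z \<and> mdist Y (f z) (f y) < \<delta> \<longrightarrow> mdist Z z y < e"
        using e unfolding Z(4) d_def
        by (intro exI[of _ e]) (auto simp: scale_dist_def)
    qed
    also have "|(q ` mspace Z) \<times> K| \<le>o |K|"
    proof -
      have "|q ` mspace Z| \<le>o |K|" using ZX by (intro subset_ordLeq[OF _ q(1)]) auto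
      then show ?thesis by (rule Times_ordLeq[OF infK _ card_of_mono1[OF subset_refl]])
    qed
    finally show "weight Z \<le>o weight Y" using K(2) by simp
  qed
qed

theorem theorem1p1:
  fixes X :: "'a metric" and Y :: "'b metric" and f :: "'a \<Rightarrow> 'b"
  assumes "coarsely_continuous X Y f"
  shows "\<exists>(Z :: 'a metric) (g :: 'a \<Rightarrow> 'a) (h :: 'a \<Rightarrow> 'b).
           coarsely_continuous X Z g \<and> coarsely_continuous Z Y h \<and>
           (\<forall>x\<in>mspace X. f x = (h \<circ> g) x) \<and>
           asdim Z \<le> asdim X \<and> weight Z \<le>o weight Y"
proof (cases "asdim X = \<infinity> \<or> finite (mspace Y) \<or> mspace X = {}")
  case True
  obtain Z :: "'a metric" and g where Z: "coarsely_continuous X Z g" "coarsely_continuous Z Y f"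
    "\<And>x. x \<in> mspace X \<Longrightarrow> f x = f (g x)" "weight Z \<le>o weight Y"
    "finite (f ` mspace X) \<Longrightarrow> asdim_le Z 0"
    using factor_through_image[OF assms] by blast
  have "asdim Z \<le> asdim X"
  proof (cases "asdim X = \<infinity>")
    case False
    with True have "finite (f ` mspace X)"
      using assms by (auto simp: coarsely_continuous_def intro: finite_subset)
    then have "asdim Z \<le> enat 0" using Z(5) asdim_le_imp_asdim_le by blast
    then show ?thesis by (simp add: zero_enat_def[symmetric])
  qed simp
  with Z show ?thesis by (metis comp_apply)
next
  case False
  then obtain n x0 where n: "asdim X = enat n" "asdim_le X n" and x0: "x0 \<in> mspace X"
    using asdim_finiteE by blast
  have "infinite (mspace Y)" using False by simp
  then obtain Z :: "'a metric" and g where Z: "coarsely_continuous X Z g" "coarsely_continuous Z Y f"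
    "\<And>x. x \<in> mspace X \<Longrightarrow> f x = f (g x)" "asdim_le Z n" "weight Z \<le>o weight Y"
    using factor_through_tower[OF assms n(2) x0] by blast
  have "asdim Z \<le> asdim X" using asdim_le_imp_asdim_le[OF Z(4)] n(1) by simp
  with Z show ?thesis by (metis comp_apply)
qed

end
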